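(* Let $n\in\{1,2,3\}$. If a system $S\subseteq E_n$ has only finitely many solutions in integers $x_1,\ldots,x_n$, then each such solution $(x_1,\ldots,x_n)$ satisfies $|x_1|,\ldots,|x_n|\le 2^{2^{n-1}}$.
   Context: For a positive integer $n$, $E_n=\{x_i=1,\ x_i+x_j=x_k,\ x_i\cdot x_j=x_k:\ i,j,k\in\{1,\ldots,n\}\}$; a system $S\subseteq E_n$ is a set of such equations in the variables $x_1,\ldots,x_n$. *)

theory Defs
  imports Main "HOL-Library.FuncSet"
begin

text \<open>Equations are kept syntactic; variables are denoted by their indices.\<close>

datatype equation =
    One nat           \<comment> \<open>\<open>One i\<close> is the equation \<open>x\<^sub>i = 1\<close>\<close>
  | Add nat nat nat   \<comment> \<open>\<open>Add i j k\<close> is the equation \<open>x\<^sub>i + x\<^sub>j = x\<^sub>k\<close>\<close>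
  | Mult nat nat nat  \<comment> \<open>\<open>Mult i j k\<close> is the equation \<open>x\<^sub>i \<cdot> x\<^sub>j = x\<^sub>k\<close>\<close>

definition E :: "nat \<Rightarrow> equation set" where
  "E n = {One i |i. i \<in> {1..n}}
       \<union> {Add i j k |i j k. i \<in> {1..n} \<and> j \<in> {1..n} \<and> k \<in> {1..n}}
       \<union> {Mult i j k |i j k. i \<in> {1..n} \<and> j \<in> {1..n} \<and> k \<in> {1..n}}"

primrec satisfies :: "(nat \<Rightarrow> int) \<Rightarrow> equation \<Rightarrow> bool" where
  "satisfies x (One i) \<longleftrightarrow> x i = 1"
| "satisfies x (Add i j k) \<longleftrightarrow> x i + x j = x k"
| "satisfies x (Mult i j k) \<longleftrightarrow> x i * x j = x k"

text \<open>
  An integer tuple \<open>(x\<^sub>1, \<dots>, x\<^sub>n)\<close> is an extensional function on \<open>{1..n}\<close>, so that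
  distinct elements of the following set are distinct tuples and its finiteness means
  that there are finitely many integer solutions.
\<close>

definition solutions :: "nat \<Rightarrow> equation set \<Rightarrow> (nat \<Rightarrow> int) set" where
  "solutions n S = {x \<in> {1..n} \<rightarrow>\<^sub>E (UNIV :: int set). \<forall>e\<in>S. satisfies x e}"

end

theory Submission
  imports Defs
begin

text \<open>
  Enlarge \<open>S\<close> to the set of all equations that a given solution satisfies and assume that the
  entry \<open>c\<close> of largest absolute value exceeds the bound; it then suffices to deform the solution in
  a one-parameter family that keeps all these equations. For \<open>n = 3\<close> (the cases \<open>n \<le> 2\<close> are
  similar but simpler) let \<open>\<bar>a\<bar> \<le> \<bar>b\<bar> \<le> \<bar>c\<bar>\<close> and \<open>\<bar>c\<bar> > 16\<close>. If
  \<open>\<bar>b\<bar> \<le> 4\<close>, then no sum or product of the small entries reaches \<open>c\<close>, which is therefore free. If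
  \<open>a \<in> {0, 1}\<close>, essentially one relation at most ties \<open>b\<close> to \<open>c\<close>. Otherwise, a system of additive equations
  only is kept by scaling, a system of multiplicative equations only by raising all entries to a
  power, and a mixed system consists, by size, of one equation of each kind, which define a
  rational curve such as \<open>(t, 2t, t\<^sup>2)\<close> with infinitely many integer points.
\<close>

section \<open>Deformations of a solution\<close>

definition preserved :: "nat set \<Rightarrow> (nat \<Rightarrow> int) \<Rightarrow> (nat \<Rightarrow> int) \<Rightarrow> bool" where
  "preserved I x y \<longleftrightarrow>
     (\<forall>u\<in>I. x u = 1 \<longrightarrow> y u = 1) \<and>
     (\<forall>u\<in>I. \<forall>v\<in>I. \<forall>w\<in>I. x u + x v = x w \<longrightarrow> y u + y v = y w) \<and>
     (\<forall>u\<in>I. \<forall>v\<in>I. \<forall>w\<in>I. x u * x v = x w \<longrightarrow> y u * y v = y w)"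

text \<open>Injectivity in one coordinate already makes the tuples distinct. An arbitrary index set
  \<open>I\<close> allows the entries to be listed by size later.\<close>

definition deformable :: "nat set \<Rightarrow> (nat \<Rightarrow> int) \<Rightarrow> bool" where
  "deformable I x \<longleftrightarrow>
     (\<exists>y :: nat \<Rightarrow> nat \<Rightarrow> int. (\<exists>i\<in>I. inj (\<lambda>t. y t i)) \<and> (\<forall>t. preserved I x (y t)))"

text \<open>Every equation of \<open>S\<close> holds for \<open>x\<close> and has its indices in
  \<open>{1..n}\<close>, so each \<open>y t\<close> inherits it; restricting makes
  \<open>y t\<close> an extensional tuple without changing these entries.\<close>

lemma deformable_imp_infinite_solutions:
  assumes S: "S \<subseteq> E n" and x: "x \<in> solutions n S" and "deformable {1..n} x"
  shows "infinite (solutions n S)"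
proof -
  obtain y :: "nat \<Rightarrow> nat \<Rightarrow> int" and i
    where i: "i \<in> {1..n}" and inj: "inj (\<lambda>t. y t i)" and pres: "\<And>t. preserved {1..n} x (y t)"
    using assms(3) unfolding deformable_def by blast
  let ?r = "\<lambda>t. restrict (y t) {1..n}"
  have "satisfies (?r t) e" if e: "e \<in> S" for t e
  proof -
    have xe: "satisfies x e" using x e by (simp add: solutions_def)
    have "e \<in> E n" using S e by blast
    then show ?thesis
      using xe pres[of t] unfolding E_def preserved_def by auto
  qed
  then have sub: "range ?r \<subseteq> solutions n S"
    unfolding solutions_def by auto
  have "inj ?r"
  proof (rule injI)
    fix s t assume "?r s = ?r t"
    then have "?r s i = ?r t i" by simp
    then have "y s i = y t i" using i by simp
    then show "s = t" using inj by (simp add: inj_def)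
  qed
  then have "infinite (range ?r)" by (simp add: finite_image_iff)
  then show ?thesis using sub finite_subset by blast
qed

lemma deformable_tripleI:
  fixes x :: "nat \<Rightarrow> int" and f g h :: "nat \<Rightarrow> int"
  assumes "i \<noteq> j" "i \<noteq> k" "j \<noteq> k"
    and "inj f \<or> inj g \<or> inj h"
    and "\<And>t. preserved {i, j, k} x ((\<lambda>_. 0)(i := f t, j := g t, k := h t))"
  shows "deformable {i, j, k} x"
  unfolding deformable_def
proof (intro exI conjI allI)
  let ?y = "\<lambda>t. (\<lambda>_. 0)(i := f t, j := g t, k := h t)"
  show "\<exists>m\<in>{i, j, k}. inj (\<lambda>t. ?y t m)"
    using assms(1-4) by (auto simp: eta_contract_eq)
  show "preserved {i, j, k} x (?y t)" for t by fact
qed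

section \<open>Linear lower bounds for products\<close>

lemma square_lower_bound:
  fixes b m :: int
  assumes "m \<le> \<bar>b\<bar>" "0 \<le> m"
  shows "m * \<bar>b\<bar> \<le> b * b"
  using mult_right_mono[OF assms(1), of "\<bar>b\<bar>"] by simp

lemma product_lower_bound:
  fixes b c m :: int
  assumes "m \<le> \<bar>b\<bar>" "0 \<le> m"
  shows "m * \<bar>c\<bar> \<le> \<bar>b * c\<bar>"
  using mult_right_mono[OF assms(1), of "\<bar>c\<bar>"] by (simp add: abs_mult)

section \<open>Triples with two small entries\<close>

text \<open>Since \<open>4 * 4 = 16 < |x k|\<close>, an equation involving \<open>x k\<close> can
  hold only as an identity such as \<open>0 * c = 0\<close>, \<open>1 * c = c\<close> or
  \<open>0 + c = c\<close>. These survive any change of \<open>x k\<close>.\<close>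

lemma deformable_small_pair:
  fixes x :: "nat \<Rightarrow> int"
  assumes d: "i \<noteq> j" "i \<noteq> k" "j \<noteq> k"
    and a: "\<bar>x i\<bar> \<le> 4" and b: "\<bar>x j\<bar> \<le> 4" and c: "16 < \<bar>x k\<bar>"
  shows "deformable {i, j, k} x"
proof (rule deformable_tripleI[OF d, of "\<lambda>_. x i" "\<lambda>_. x j" int])
  have prod: "\<bar>u * v\<bar> \<le> 16" if "\<bar>u\<bar> \<le> 4" "\<bar>v\<bar> \<le> 4" for u v :: int
    using mult_mono[OF that] by (simp add: abs_mult)
  have big: "u = 0 \<and> v = 0" if "u * x k = v" "\<bar>v\<bar> \<le> 4" for u v
  proof -
    have "u = 0"
    proof (rule ccontr)
      assume "u \<noteq> 0"
      then have "\<bar>x k\<bar> \<le> \<bar>u * x k\<bar>" using product_lower_bound[of 1 u "x k"] by simp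
      then show False using that c by linarith
    qed
    then show ?thesis using that by simp
  qed
  have cc: "17 * \<bar>x k\<bar> \<le> x k * x k" using c by (intro square_lower_bound) auto
  have add_ne: "x i + x i \<noteq> x k" "x i + x j \<noteq> x k" "x j + x j \<noteq> x k"
      "x i + x k \<noteq> x i" "x i + x k \<noteq> x j" "x j + x k \<noteq> x i" "x j + x k \<noteq> x j"
      "x k + x k \<noteq> x i" "x k + x k \<noteq> x j" "x k + x k \<noteq> x k" "x k \<noteq> 1"
    using a b c by linarith+
  have mult_ne: "x i * x i \<noteq> x k" "x i * x j \<noteq> x k" "x j * x j \<noteq> x k"
      "x k * x k \<noteq> x i" "x k * x k \<noteq> x j" "x k * x k \<noteq> x k"
    using a b c cc prod[OF a a] prod[OF a b] prod[OF b b] by linarith+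
  show "preserved {i, j, k} x ((\<lambda>_. 0)(i := x i, j := x j, k := int t))" for t
  proof -
    have zero: "x i * x k = x i \<longrightarrow> x i * int t = x i" "x i * x k = x j \<longrightarrow> x i * int t = x j"
        "x j * x k = x i \<longrightarrow> x j * int t = x i" "x j * x k = x j \<longrightarrow> x j * int t = x j"
      by (metis big a b mult_zero_left)+
    have unit: "x i * x k = x k \<longrightarrow> x i * int t = int t" "x j * x k = x k \<longrightarrow> x j * int t = int t"
        "x i + x k = x k \<longrightarrow> x i + int t = int t" "x j + x k = x k \<longrightarrow> x j + int t = int t"
      using c by auto
    \<comment> \<open>These instances put all sums and products in the order \<open>i\<close>,
      \<open>j\<close>, \<open>k\<close>, so that mirrored equations coincide with those treated
      above.\<close>
    have comm: "x j + x i = x i + x j" "x k + x i = x i + x k" "x k + x j = x j + x k"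
        "x j * x i = x i * x j" "x k * x i = x i * x k" "x k * x j = x j * x k"
        "int t + x i = x i + int t" "int t + x j = x j + int t"
        "int t * x i = x i * int t" "int t * x j = x j * int t"
      by simp_all
    define y where "y = (\<lambda>_. 0)(i := x i, j := x j, k := int t)"
    have y: "y i = x i" "y j = x j" "y k = int t" using d by (auto simp: y_def)
    have "preserved {i, j, k} x y"
      unfolding preserved_def ball_simps y comm
      using add_ne mult_ne zero unit by blast
    then show ?thesis by (simp add: y_def)
  qed
qed auto

section \<open>Triples with an entry 0 or 1\<close>

text \<open>
  The equations that can hold when \<open>a \<in> {0, 1}\<close> and \<open>b\<close>, \<open>c\<close> are large; \<open>b = c\<close> encodes
  \<open>a + b = c\<close> or \<open>a \<cdot> b = c\<close>.
\<close>

definition nontrivial_preserved_unit :: "int \<Rightarrow> int \<Rightarrow> int \<Rightarrow> int \<Rightarrow> int \<Rightarrow> bool" where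
  "nontrivial_preserved_unit a b c b' c' \<longleftrightarrow>
     (b = c \<longrightarrow> b' = c') \<and> (2 * b = c \<longrightarrow> 2 * b' = c') \<and> (a + b = c \<longrightarrow> a + b' = c') \<and>
     (a + c = b \<longrightarrow> a + c' = b') \<and> (b + c = a \<longrightarrow> b' + c' = a) \<and> (b * b = c \<longrightarrow> b' * b' = c')"

text \<open>By size, \<open>x j * x k\<close> and \<open>x k * x k\<close> equal no entry, and
  \<open>x j * x j\<close> can only equal \<open>x k\<close>. An equation with factor
  \<open>x i\<close> is an identity, fails, or says \<open>x j = x k\<close>.\<close>

lemma deformable_unitI:
  fixes x :: "nat \<Rightarrow> int" and g h :: "nat \<Rightarrow> int"
  assumes d: "i \<noteq> j" "i \<noteq> k" "j \<noteq> k"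
    and a: "x i = 0 \<or> x i = 1" and b: "5 \<le> \<bar>x j\<bar>" and bc: "\<bar>x j\<bar> \<le> \<bar>x k\<bar>"
    and inj: "inj g \<or> inj h"
    and pres: "\<And>t. nontrivial_preserved_unit (x i) (x j) (x k) (g t) (h t)"
  shows "deformable {i, j, k} x"
proof (rule deformable_tripleI[OF d, of "\<lambda>_. x i" g h])
  have bb: "5 * \<bar>x j\<bar> \<le> x j * x j" using b by (intro square_lower_bound) auto
  have cc: "5 * \<bar>x k\<bar> \<le> x k * x k" using b bc by (intro square_lower_bound) auto
  have xb: "5 * \<bar>x k\<bar> \<le> \<bar>x j * x k\<bar>" using b by (intro product_lower_bound) auto
  have a01: "0 \<le> x i" "x i \<le> 1" using a by auto
  have nz: "x j \<noteq> 0" "x k \<noteq> 0" using b bc by auto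
  have ne: "x j * x k \<noteq> x i" "x j * x k \<noteq> x j" "x j * x k \<noteq> x k"
      "x j * x j \<noteq> x i" "x j * x j \<noteq> x j" "x k * x k \<noteq> x i" "x k * x k \<noteq> x j" "x k * x k \<noteq> x k"
      "x j \<noteq> 1" "x k \<noteq> 1"
      "x i + x i \<noteq> x j" "x i + x i \<noteq> x k" "x j + x j \<noteq> x i" "x j + x j \<noteq> x j"
      "x k + x k \<noteq> x i" "x k + x k \<noteq> x j" "x k + x k \<noteq> x k"
      "x i + x j \<noteq> x i" "x i + x k \<noteq> x i" "x j + x k \<noteq> x j" "x j + x k \<noteq> x k"
    using a01 b bc bb cc xb by linarith+
  show "preserved {i, j, k} x ((\<lambda>_. 0)(i := x i, j := g t, k := h t))" for t
  proof -
    have pr: "x j + x j = x k \<longrightarrow> g t + g t = h t" "x i + x j = x k \<longrightarrow> x i + g t = h t"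
        "x i + x k = x j \<longrightarrow> x i + h t = g t" "x j + x k = x i \<longrightarrow> g t + h t = x i"
        "x j * x j = x k \<longrightarrow> g t * g t = h t"
      using pres[of t] by (simp_all add: nontrivial_preserved_unit_def)
    have p: "x j = x k \<longrightarrow> g t = h t" using pres[of t] by (simp add: nontrivial_preserved_unit_def)
    have unit: "x i * x i = x j \<longrightarrow> x i * x i = g t" "x i * x i = x k \<longrightarrow> x i * x i = h t"
        "x i * x j = x i \<longrightarrow> x i * g t = x i" "x i * x k = x i \<longrightarrow> x i * h t = x i"
        "x i * x j = x j \<longrightarrow> x i * g t = g t" "x i * x k = x k \<longrightarrow> x i * h t = h t"
        "x i + x j = x j \<longrightarrow> x i + g t = g t" "x i + x k = x k \<longrightarrow> x i + h t = h t"
      using a nz ne by auto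
    have eq: "x i * x j = x k \<longrightarrow> x i * g t = h t" "x i * x k = x j \<longrightarrow> x i * h t = g t"
      using a nz p by auto
    have comm: "x j + x i = x i + x j" "x k + x i = x i + x k" "x k + x j = x j + x k"
        "x j * x i = x i * x j" "x k * x i = x i * x k" "x k * x j = x j * x k"
        "g t + x i = x i + g t" "h t + x i = x i + h t" "h t + g t = g t + h t"
        "g t * x i = x i * g t" "h t * x i = x i * h t" "h t * g t = g t * h t"
      by simp_all
    define y where "y = (\<lambda>_. 0)(i := x i, j := g t, k := h t)"
    have y: "y i = x i" "y j = g t" "y k = h t" using d by (auto simp: y_def)
    have "preserved {i, j, k} x y"
      unfolding preserved_def ball_simps y comm
      by (intro conjI impI)
        (rule TrueI | assumption | erule ne[THEN notE] unit[THEN mp] eq[THEN mp] pr[THEN mp])+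
    then show ?thesis by (simp add: y_def)
  qed
qed (use inj in auto)

text \<open>Two different listed relations hold together only if they coincide because
  \<open>x i = 0\<close>; hence the curve solving one relation keeps all that hold.\<close>

lemma deformable_unit_entry:
  fixes x :: "nat \<Rightarrow> int"
  assumes d: "i \<noteq> j" "i \<noteq> k" "j \<noteq> k"
    and a: "x i = 0 \<or> x i = 1" and b: "5 \<le> \<bar>x j\<bar>" and bc: "\<bar>x j\<bar> \<le> \<bar>x k\<bar>"
  shows "deformable {i, j, k} x"
proof -
  have bb: "5 * \<bar>x j\<bar> \<le> x j * x j" using b by (intro square_lower_bound) auto
  note fam = deformable_unitI[OF d a b bc, unfolded nontrivial_preserved_unit_def]
  consider "x k = x j" | "2 * x j = x k" | "x i + x j = x k" "x k \<noteq> x j" | "x i + x k = x j" "x k \<noteq> x j"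
    | "x j + x k = x i" | "x j * x j = x k"
    | "x k \<noteq> x j" "2 * x j \<noteq> x k" "x i + x j \<noteq> x k" "x i + x k \<noteq> x j" "x j + x k \<noteq> x i" "x j * x j \<noteq> x k"
    by blast
  then show ?thesis
  proof cases
    case 1
    show ?thesis
      by (rule fam[of int int]) (use 1 a b bb in auto)
  next
    case 2
    show ?thesis
      by (rule fam[of int "\<lambda>t. 2 * int t"]) (use 2 a b bb in auto)
  next
    case 3
    show ?thesis
      by (rule fam[of int "\<lambda>t. x i + int t"]) (use 3 a b bb in auto)
  next
    case 4
    show ?thesis
      by (rule fam[of "\<lambda>t. x i + int t" int]) (use 4 a b bb in auto)
  next
    case 5
    show ?thesis
      by (rule fam[of int "\<lambda>t. x i - int t"]) (use 5 a b bb in auto)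
  next
    case 6
    show ?thesis
      by (rule fam[of int "\<lambda>t. int t * int t"]) (use 6 a b bb in auto)
  next
    case 7
    show ?thesis
      by (rule fam[of "\<lambda>_. x j" int]) (use 7 in auto)
  qed
qed

section \<open>Triples without a small or degenerate entry\<close>

text \<open>
  The equations that can hold when \<open>\<bar>a\<bar> \<le> \<bar>b\<bar> \<le> \<bar>c\<bar>\<close>, \<open>a \<notin> {0, 1}\<close> and \<open>b\<close> is large.
\<close>

definition nontrivial_preserved :: "int \<Rightarrow> int \<Rightarrow> int \<Rightarrow> int \<Rightarrow> int \<Rightarrow> int \<Rightarrow> bool" where
  "nontrivial_preserved a b c a' b' c' \<longleftrightarrow>
     (2 * a = b \<longrightarrow> 2 * a' = b') \<and> (2 * a = c \<longrightarrow> 2 * a' = c') \<and> (2 * b = c \<longrightarrow> 2 * b' = c') \<and>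
     (a + b = c \<longrightarrow> a' + b' = c') \<and> (a + c = b \<longrightarrow> a' + c' = b') \<and> (b + c = a \<longrightarrow> b' + c' = a') \<and>
     (a * a = b \<longrightarrow> a' * a' = b') \<and> (a * a = c \<longrightarrow> a' * a' = c') \<and> (b * b = c \<longrightarrow> b' * b' = c') \<and>
     (a * b = c \<longrightarrow> a' * b' = c') \<and> (a * c = b \<longrightarrow> a' * c' = b')"

text \<open>\<open>x i\<close> being neither 0 nor 1 excludes \<open>a + c = c\<close>,
  \<open>a * c = c\<close> and the like; the other unlisted equations fail by size.\<close>

lemma deformable_nondegenerateI:
  fixes x :: "nat \<Rightarrow> int" and f g h :: "nat \<Rightarrow> int"
  assumes d: "i \<noteq> j" "i \<noteq> k" "j \<noteq> k"
    and ord: "\<bar>x i\<bar> \<le> \<bar>x j\<bar>" "\<bar>x j\<bar> \<le> \<bar>x k\<bar>"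
    and a: "x i \<noteq> 0" "x i \<noteq> 1" and b: "5 \<le> \<bar>x j\<bar>"
    and inj: "inj f \<or> inj g \<or> inj h"
    and pres: "\<And>t. nontrivial_preserved (x i) (x j) (x k) (f t) (g t) (h t)"
  shows "deformable {i, j, k} x"
proof (rule deformable_tripleI[OF d inj])
  fix t
  have bb: "5 * \<bar>x j\<bar> \<le> x j * x j" using b by (intro square_lower_bound) auto
  have cc: "5 * \<bar>x k\<bar> \<le> x k * x k" using b ord by (intro square_lower_bound) auto
  have bc: "5 * \<bar>x k\<bar> \<le> \<bar>x j * x k\<bar>" using b by (intro product_lower_bound) auto
  have ne: "x j * x k \<noteq> x i" "x j * x k \<noteq> x j" "x j * x k \<noteq> x k"
      "x j * x j \<noteq> x i" "x j * x j \<noteq> x j" "x k * x k \<noteq> x i" "x k * x k \<noteq> x j" "x k * x k \<noteq> x k"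
    using b ord bb cc bc by linarith+
  have ne2: "x i * x k \<noteq> x i" "x i * x k \<noteq> x k" "x i * x j \<noteq> x i" "x i * x j \<noteq> x j" "x i * x i \<noteq> x i"
    using a b ord by auto
  have ne3: "x i \<noteq> 1" "x j \<noteq> 1" "x k \<noteq> 1"
      "x i + x i \<noteq> x i" "x j + x j \<noteq> x i" "x j + x j \<noteq> x j" "x k + x k \<noteq> x i" "x k + x k \<noteq> x j"
      "x k + x k \<noteq> x k" "x i + x j \<noteq> x i" "x i + x j \<noteq> x j" "x i + x k \<noteq> x i" "x i + x k \<noteq> x k"
      "x j + x k \<noteq> x j" "x j + x k \<noteq> x k"
    using a b ord by linarith+
  have comm: "x j + x i = x i + x j" "x k + x i = x i + x k" "x k + x j = x j + x k"
      "x j * x i = x i * x j" "x k * x i = x i * x k" "x k * x j = x j * x k"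
      "g t + f t = f t + g t" "h t + f t = f t + h t" "h t + g t = g t + h t"
      "g t * f t = f t * g t" "h t * f t = f t * h t" "h t * g t = g t * h t"
    by simp_all
  define y where "y = (\<lambda>_. 0)(i := f t, j := g t, k := h t)"
  have y: "y i = f t" "y j = g t" "y k = h t" using d by (auto simp: y_def)
  have "preserved {i, j, k} x y"
    unfolding preserved_def ball_simps y comm
    using ne ne2 ne3 pres[of t, unfolded nontrivial_preserved_def mult_2] by blast
  then show "preserved {i, j, k} x ((\<lambda>_. 0)(i := f t, j := g t, k := h t))"
    by (simp add: y_def)
qed

text \<open>\<open>L\<close> and \<open>M\<close> say that some additive, respectively
  multiplicative, equation holds. If both do, \<open>|a| <= 2\<close> leaves only
  \<open>a = 2\<close>, \<open>c = 2 * b\<close>; for \<open>|a| >= 3\<close> exactly one equation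
  of each kind holds, and solving both gives polynomials in one parameter.\<close>

lemma nontrivial_preserved_families:
  fixes a b c :: int
  assumes ord: "\<bar>a\<bar> \<le> \<bar>b\<bar>" "\<bar>b\<bar> \<le> \<bar>c\<bar>" and a: "a \<noteq> 0" "a \<noteq> 1" and b: "5 \<le> \<bar>b\<bar>" and c: "16 < \<bar>c\<bar>"
  shows "\<exists>f g h :: nat \<Rightarrow> int. (inj f \<or> inj g \<or> inj h) \<and> (\<forall>t. nontrivial_preserved a b c (f t) (g t) (h t))"
proof -
  define L where "L \<longleftrightarrow> 2 * a = b \<or> 2 * a = c \<or> 2 * b = c \<or> a + b = c \<or> a + c = b \<or> b + c = a"
  define M where "M \<longleftrightarrow> a * a = b \<or> a * a = c \<or> b * b = c \<or> a * b = c \<or> a * c = b"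
  have inj_mult: "inj (\<lambda>t. m * int t)" if "m \<noteq> 0" for m
    using that by (auto intro: injI)
  have I: ?thesis if "inj f \<or> inj g \<or> inj h" "\<And>t. nontrivial_preserved a b c (f t) (g t) (h t)"
    for f g h :: "nat \<Rightarrow> int"
    using that by blast
  note defs = nontrivial_preserved_def
  have bb: "5 * \<bar>b\<bar> \<le> b * b" using b by (intro square_lower_bound) auto
  consider "\<not> M" | "\<not> L" | "L" "M" "\<bar>a\<bar> \<le> 2" | "L" "M" "3 \<le> \<bar>a\<bar>" by linarith
  then show ?thesis
  proof cases
    case 1
    show ?thesis
    proof (rule I)
      show "inj (\<lambda>t. a * int t) \<or> inj (\<lambda>t. b * int t) \<or> inj (\<lambda>t. c * int t)"
        using inj_mult a by blast
      show "nontrivial_preserved a b c (a * int t) (b * int t) (c * int t)" for t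
        using 1 unfolding M_def defs by (auto simp flip: distrib_right)
    qed
  next
    case 2
    have "inj (\<lambda>t. c ^ t)"
    proof (rule injI)
      \<comment> \<open>Absolute values cover negative \<open>c\<close>; exponents are determined
        because \<open>|c| > 1\<close>.\<close>
      fix s t assume "c ^ s = c ^ t"
      then have "\<bar>c\<bar> ^ s = \<bar>c\<bar> ^ t" by (simp flip: power_abs)
      then show "s = t" using c by (simp add: power_inject_exp)
    qed
    moreover have "nontrivial_preserved a b c (a ^ t) (b ^ t) (c ^ t)" for t
      using 2 unfolding L_def defs by (auto simp flip: power_mult_distrib)
    ultimately show ?thesis
      by (intro I[of "\<lambda>t. a ^ t" "\<lambda>t. b ^ t" "\<lambda>t. c ^ t"]) auto
  next
    case 3
    \<comment> \<open>For each fixed value of \<open>a\<close>, naming the square of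
      \<open>b\<close> makes all the facts linear.\<close>
    define s where "s = b * b"
    note facts = \<open>L\<close>[unfolded L_def] \<open>M\<close>[unfolded M_def, folded s_def] ord b c bb[folded s_def]
    consider "a = 2" | "a = -1" | "a = -2" using 3(3) a by linarith
    then have eq: "a = 2 \<and> c = 2 * b"
    proof cases
      case 1
      show ?thesis using facts unfolding 1 by simp linarith
    next
      case 2
      show ?thesis using facts unfolding 2 by simp linarith
    next
      case 3
      show ?thesis using facts unfolding 3 by simp linarith
    qed
    show ?thesis
      by (rule I[of "\<lambda>_. 2" int "\<lambda>t. 2 * int t"]) (use eq b bb in \<open>auto simp: defs\<close>)
  next
    case 4
    have aa: "3 * \<bar>a\<bar> \<le> a * a" using 4 by (intro square_lower_bound) auto
    \<comment> \<open>A second additive equation may require \<open>a * a = 3 * a\<close> or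
      \<open>a * a = 4 * a\<close>, hence \<open>a * a <= 16\<close>, which conflicts with
      \<open>16 < |c|\<close>. The triple \<open>(4, 8, 16)\<close>, with \<open>2 * a = b\<close>,
      \<open>2 * b = c\<close> and \<open>a * a = c\<close>, shows that 16 is attained.\<close>
    have aa5: "5 * \<bar>a\<bar> \<le> a * a \<or> a * a \<le> 16"
      using square_lower_bound[of 5 a] mult_mono[of "\<bar>a\<bar>" 4 "\<bar>a\<bar>" 4] by fastforce
    have ab: "3 * \<bar>b\<bar> \<le> \<bar>a * b\<bar>" using 4 by (intro product_lower_bound) auto
    have ac: "3 * \<bar>c\<bar> \<le> \<bar>a * c\<bar>" using 4 by (intro product_lower_bound) auto
    have nac: "a * c \<noteq> b" using ac b ord by linarith
    consider (A) "2 * a = b" | (B) "2 * b = c" | (C) "a + b = c" | (D) "a + c = b" | (E) "b + c = a"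
      | (F) "2 * a = c" using \<open>L\<close> unfolding L_def by blast
    then show ?thesis
    proof cases
      case A
      \<comment> \<open>Both products become multiples of \<open>a * a\<close>, which then acts as a
        single unknown in linear comparisons.\<close>
      have sq: "b * b = 4 * (a * a)" "a * b = 2 * (a * a)" using A by auto
      consider "a * a = c" | "b * b = c" | "a * b = c"
        using \<open>M\<close> nac A aa 4 unfolding M_def by linarith
      then show ?thesis
      proof cases
        case 1
        show ?thesis
          by (rule I[of int "\<lambda>t. 2 * int t" "\<lambda>t. int t * int t"])
            (simp, unfold defs, (intro conjI impI; use 1 A nac sq aa aa5 4 c in linarith))
      next
        case 2
        show ?thesis
          by (rule I[of int "\<lambda>t. 2 * int t" "\<lambda>t. 4 * (int t * int t)"])
            (simp, unfold defs, (intro conjI impI; use 2 A nac sq aa aa5 4 c in linarith))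
      next
        case 3
        show ?thesis
          by (rule I[of int "\<lambda>t. 2 * int t" "\<lambda>t. 2 * (int t * int t)"])
            (simp, unfold defs, (intro conjI impI; use 3 A nac sq aa aa5 4 c in linarith))
      qed
    next
      case B
      \<comment> \<open>Here, as in cases \<open>C\<close>, \<open>D\<close> and \<open>E\<close>,
        \<open>|c| <= 2 * |b|\<close>, so products with factor \<open>b\<close> are too large and
        only \<open>a * a\<close> can equal \<open>b\<close> or \<open>c\<close>.\<close>
      have ne: "b * b \<noteq> c" "a * b \<noteq> c" "a * c \<noteq> b"
        using B ab bb ord b nac by linarith+
      consider "a * a = b" | "a * a = c"
        using \<open>M\<close> ne unfolding M_def by blast
      then show ?thesis
      proof cases
        case 1
        show ?thesis
          by (rule I[of int "\<lambda>t. int t * int t" "\<lambda>t. 2 * (int t * int t)"])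
            (simp, unfold defs, (intro conjI impI;
             use 1 B ne aa aa5 4 c in linarith))
      next
        \<comment> \<open>\<open>2 * b = a * a\<close> forces \<open>a\<close> to be even; taking
          \<open>a / 2\<close> as the parameter keeps \<open>b\<close> integral.\<close>
        case 2
        then have "even (a * a)" using B by (metis dvd_triv_left)
        then obtain d where d: "a = 2 * d" by auto
        have dd: "a * a = 4 * (d * d)" using d by simp
        show ?thesis
          by (rule I[of "\<lambda>t. 2 * int t" "\<lambda>t. 2 * (int t * int t)" "\<lambda>t. 4 * (int t * int t)"])
            (use inj_mult[of 2] in simp, unfold defs, (intro conjI impI;
             use 2 B ne aa aa5 4 c dd d in linarith))
      qed
    next
      case C
      have ne: "b * b \<noteq> c" "a * b \<noteq> c" "a * c \<noteq> b"
        using C ab bb ord b nac by linarith+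
      consider "a * a = b" | "a * a = c"
        using \<open>M\<close> ne unfolding M_def by blast
      then show ?thesis
      proof cases
        case 1
        show ?thesis
          by (rule I[of int "\<lambda>t. int t * int t" "\<lambda>t. int t + int t * int t"])
            (simp, unfold defs, (intro conjI impI;
             use 1 C ne aa aa5 4 c in linarith))
      next
        case 2
        show ?thesis
          by (rule I[of int "\<lambda>t. int t * int t - int t" "\<lambda>t. int t * int t"])
            (simp, unfold defs, (intro conjI impI;
             use 2 C ne aa aa5 4 c in linarith))
      qed
    next
      case D
      have ne: "b * b \<noteq> c" "a * b \<noteq> c" "a * c \<noteq> b"
        using D ab bb ord b nac by linarith+
      consider "a * a = b" | "a * a = c"
        using \<open>M\<close> ne unfolding M_def by blast
      then show ?thesis
      proof cases
        case 1
        show ?thesis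
          by (rule I[of int "\<lambda>t. int t * int t" "\<lambda>t. int t * int t - int t"])
            (simp, unfold defs, (intro conjI impI;
             use 1 D ne aa aa5 4 c in linarith))
      next
        case 2
        show ?thesis
          by (rule I[of int "\<lambda>t. int t * int t + int t" "\<lambda>t. int t * int t"])
            (simp, unfold defs, (intro conjI impI;
             use 2 D ne aa aa5 4 c in linarith))
      qed
    next
      case E
      have ne: "b * b \<noteq> c" "a * b \<noteq> c" "a * c \<noteq> b"
        using E ab bb ord b nac by linarith+
      consider "a * a = b" | "a * a = c"
        using \<open>M\<close> ne unfolding M_def by blast
      then show ?thesis
      proof cases
        case 1
        show ?thesis
          by (rule I[of int "\<lambda>t. int t * int t" "\<lambda>t. int t - int t * int t"])
            (simp, unfold defs, (intro conjI impI;
             use 1 E ne aa aa5 4 c in linarith))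
      next
        case 2
        show ?thesis
          by (rule I[of int "\<lambda>t. int t - int t * int t" "\<lambda>t. int t * int t"])
            (simp, unfold defs, (intro conjI impI;
             use 2 E ne aa aa5 4 c in linarith))
      qed
    next
      \<comment> \<open>Every product in \<open>M\<close> has absolute value at least
        \<open>3 * |a|\<close>, whereas \<open>|b| <= |c| = 2 * |a|\<close>.\<close>
      case F
      then show ?thesis
        using \<open>M\<close> nac aa ab bb ord b 4 unfolding M_def by linarith
    qed
  qed
qed

section \<open>All triples ordered by absolute value\<close>

lemma deformable_triple:
  fixes x :: "nat \<Rightarrow> int"
  assumes d: "i \<noteq> j" "i \<noteq> k" "j \<noteq> k"
    and ord: "\<bar>x i\<bar> \<le> \<bar>x j\<bar>" "\<bar>x j\<bar> \<le> \<bar>x k\<bar>" and c: "16 < \<bar>x k\<bar>"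
  shows "deformable {i, j, k} x"
proof -
  consider "\<bar>x j\<bar> \<le> 4" | "5 \<le> \<bar>x j\<bar>" "x i = 0 \<or> x i = 1" | "5 \<le> \<bar>x j\<bar>" "x i \<noteq> 0" "x i \<noteq> 1"
    by linarith
  then show ?thesis
  proof cases
    case 1
    then show ?thesis using deformable_small_pair[OF d _ 1 c] ord by linarith
  next
    case 2
    then show ?thesis using deformable_unit_entry[OF d] ord by blast
  next
    case 3
    then show ?thesis
      using nontrivial_preserved_families[OF ord 3(2,3,1) c] deformable_nondegenerateI[OF d ord 3(2,3,1)]
      by blast
  qed
qed

section \<open>One and two variables\<close>

text \<open>An entry outside \<open>{0, 1}\<close> satisfies no equation in one variable, so it is
  free.\<close>

lemma deformable_single:
  fixes x :: "nat \<Rightarrow> int"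
  assumes "2 < \<bar>x i\<bar>"
  shows "deformable {i} x"
  unfolding deformable_def preserved_def
  using assms by (intro exI[of _ "\<lambda>t _. int t"]) (auto intro: injI)

lemma deformable_pairI:
  fixes x :: "nat \<Rightarrow> int" and f g :: "nat \<Rightarrow> int"
  assumes d: "i \<noteq> j" and inj: "inj f \<or> inj g"
    and pres: "\<And>t. preserved {i, j} x ((\<lambda>_. 0)(i := f t, j := g t))"
  shows "deformable {i, j} x"
  unfolding deformable_def
  using d inj by (intro exI[of _ "\<lambda>t. (\<lambda>_. 0)(i := f t, j := g t)"] conjI allI pres) auto

text \<open>If \<open>|x i| <= 2\<close>, neither \<open>2 * x i\<close> nor
  \<open>x i * x i\<close> reaches \<open>x j\<close>, which is free. Otherwise at most one of them
  equals \<open>x j\<close>, since \<open>2 * a = a * a\<close> only for \<open>a\<close> in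
  \<open>{0, 2}\<close>; this is the origin of the bound 4.\<close>

lemma deformable_pair:
  fixes x :: "nat \<Rightarrow> int"
  assumes d: "i \<noteq> j" and ord: "\<bar>x i\<bar> \<le> \<bar>x j\<bar>" and b: "4 < \<bar>x j\<bar>"
  shows "deformable {i, j} x"
proof -
  have bb: "5 * \<bar>x j\<bar> \<le> x j * x j" using b by (intro square_lower_bound) auto
  have ne: "x j * x j \<noteq> x i" "x j * x j \<noteq> x j" "x j \<noteq> 1" "x j + x j \<noteq> x i" "x j + x j \<noteq> x j"
      "x i + x j \<noteq> x i" "x j \<noteq> 0"
    using b bb ord by linarith+
  have comm: "x j + x i = x i + x j" "x j * x i = x i * x j" by simp_all
  show ?thesis
  proof (cases "\<bar>x i\<bar> \<le> 2")
    case True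
    then have "x i \<in> {-2, -1, 0, 1, 2}" by auto
    then show ?thesis
      using b d ne comm by (intro deformable_pairI[of i j "\<lambda>_. x i" int]) (auto simp: preserved_def)
  next
    case False
    have aa: "3 * \<bar>x i\<bar> \<le> x i * x i" using False by (intro square_lower_bound) auto
    have ab: "3 * \<bar>x j\<bar> \<le> \<bar>x i * x j\<bar>" using False by (intro product_lower_bound) auto
    have ne2: "x i * x i \<noteq> x i" "x i \<noteq> 1" "x i \<noteq> 0" "x i + x i \<noteq> x i" "x i + x j \<noteq> x j"
      "x i * x j \<noteq> x i" "x i * x j \<noteq> x j"
      using False aa ab ord b by linarith+
    note facts = d ne ne2 comm
    consider "x i + x i = x j" "x i * x i \<noteq> x j" | "x i * x i = x j" "x i + x i \<noteq> x j"
      | "x i + x i \<noteq> x j" "x i * x i \<noteq> x j"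
      using aa False by linarith
    then show ?thesis
    proof cases
      case 1
      then show ?thesis
        using facts by (intro deformable_pairI[of i j int "\<lambda>t. 2 * int t"]) (auto simp: preserved_def)
    next
      case 2
      then show ?thesis
        using facts by (intro deformable_pairI[of i j int "\<lambda>t. int t * int t"]) (auto simp: preserved_def)
    next
      case 3
      then show ?thesis
        using facts by (intro deformable_pairI[of i j "\<lambda>_. x i" int]) (auto simp: preserved_def)
    qed
  qed
qed

theorem theorem3:
  fixes n :: nat and S :: "equation set"
  assumes "n \<in> {1, 2, 3}"
    and "S \<subseteq> E n"
    and "finite (solutions n S)"
  shows "\<forall>x \<in> solutions n S. \<forall>i \<in> {1..n}. \<bar>x i\<bar> \<le> 2 ^ (2 ^ (n - 1))"
proof (intro ballI)
  fix x i assume x: "x \<in> solutions n S" and i: "i \<in> {1..n}"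
  have rigid: "\<not> deformable {1..n} x"
    using deformable_imp_infinite_solutions assms x by blast
  show "\<bar>x i\<bar> \<le> 2 ^ (2 ^ (n - 1))"
  proof (rule ccontr)
    assume large: "\<not> ?thesis"
    consider "n = 1" | "n = 2" | "n = 3" using assms(1) by blast
    then have "deformable {1..n} x"
    proof cases
      case 1
      then show ?thesis using deformable_single[of x 1] large i by simp
    next
      case 2
      have I: "{1..n} = {1, 2}" "{1..n} = {2, 1}" using 2 by auto
      have "4 < \<bar>x 1\<bar> \<or> 4 < \<bar>x 2\<bar>" using large i 2 unfolding I(1) by auto
      then show ?thesis
        using deformable_pair[of 1 2 x] deformable_pair[of 2 1 x] I by fastforce
    next
      case 3
      \<comment> \<open>Some arrangement of the indices sorts the absolute values, and
        \<open>deformable\<close> depends only on the index set.\<close>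
      obtain p q r where I: "{1..n} = {p, q, r}" and d: "p \<noteq> q" "p \<noteq> r" "q \<noteq> r"
        and ord: "\<bar>x p\<bar> \<le> \<bar>x q\<bar>" "\<bar>x q\<bar> \<le> \<bar>x r\<bar>"
      proof -
        have I: "{1..n} = {1, 2, 3}" "{1..n} = {1, 3, 2}" "{1..n} = {2, 1, 3}" "{1..n} = {2, 3, 1}"
          "{1..n} = {3, 1, 2}" "{1..n} = {3, 2, 1}" using 3 by auto
        show thesis
          using that[OF I(1)] that[OF I(2)] that[OF I(3)] that[OF I(4)] that[OF I(5)] that[OF I(6)]
          by (smt (verit) numeral_eq_iff num.distinct one_eq_numeral_iff num.inject)
      qed
      have "16 < \<bar>x r\<bar>" using large i 3 ord unfolding I by auto
      then show ?thesis using deformable_triple[OF d ord] I by simp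
    qed
    then show False using rigid by blast
  qed
qed

end
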